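(* Let $\kappa>\omega_1$ be a regular cardinal, and let $E\subseteq S^\kappa_\omega$ be stationary in $\kappa$. Let $$\mathcal{S}=\{\mathsf{lift}(A,[H_\kappa]^\omega)\mid A\subseteq E\text{ is stationary in }\kappa\}.$$ Let $\theta$ be a sufficiently large cardinal so that $\mathcal{S}\subseteq H_\theta$. Then $\mathsf{eDSRP}(\mathcal{S})$ implies that for stationarily many $W\in[H_\theta]^{\omega_1}$, we have that $\omega_1\subseteq W$ and $\rho=\sup(W\cap\kappa)$ is an exact simultaneous reflection point of $\{A\in W\mid A\subseteq E\text{ and }A\text{ is stationary in }\kappa\}$.
   Context: $[Y]^\omega$ denotes the set of countable subsets of $Y$, and $S^\kappa_\omega=\{\alpha<\kappa\mid\mathrm{cf}(\alpha)=\omega\}$. For $A\subseteq\kappa$ unbounded, $\mathsf{lift}(A,[H_\kappa]^\omega)=\{x\in[H_\kappa]^\omega\mid\sup(x\cap\kappa)\in A\}$. A sequence $\vec{Q}=\langle Q_i\mid i<\omega_1\rangle$ is an exact diagonal chain through $\mathcal{S}$ up to a set $X$ if: (1) $\vec{Q}$ is a continuous $\in$-chain of countable subsets of $H_\kappa$ ($Q_i\in Q_{i+1}$ for all $i$, $Q_\lambda=\bigcup_{i<\lambda}Q_i$ for limit $\lambda$); (2) for every $S\in X\cap\mathcal{S}$, the set $\{i<\omega_1\mid Q_i\in S\}$ is stationary in $\omega_1$; (3) $H_\kappa\cap X=\bigcup_{i<\omega_1}Q_i$, and $\langle Q_i\mid i<\alpha\rangle\in H_\kappa\cap X$ for all $\alpha<\omega_1$;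 (4) for every $i<\omega_1$, $Q_i\in\bigcup(X\cap\mathcal{S})$. $\mathsf{eDSRP}(\mathcal{S})$ says that for a sufficiently large regular $\theta$ (so that $\mathcal{S}\subseteq H_\theta$, i.e. $\theta>2^{<\kappa}$), the set of $X\in[H_\theta]^{\omega_1}$ such that $\omega_1\subseteq X$ and there is an exact diagonal chain through $\mathcal{S}$ up to $X$ is stationary in $H_\theta$. For $A\subseteq\kappa$ stationary in $\kappa$, an ordinal $\rho<\kappa$ of uncountable cofinality is a reflection point of $A$ if $A\cap\rho$ is stationary in $\rho$. For a collection $\mathcal{A}$ of stationary subsets of $\kappa$, $\rho$ is an exact simultaneous reflection point of $\mathcal{A}$ if $\rho$ is a reflection point of every $A\in\mathcal{A}$ and $(\bigcup\mathcal{A})\cap\rho$ contains a club in $\rho$. *)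

theory Defs
  imports "HOL-Library.FuncSet" "HOL-Library.Countable_Set" "HOL-Library.Equipollence"
begin

text \<open>
  The ambient set-theoretic universe is a type whose elements are the sets, with \<open>elts x\<close> the
  extension of \<open>x\<close>.  Separation and replacement are second-order, and choice is inherited from the
  logic.  Power set is not assumed: the universe may be a model of full (second-order) ZFC, but also
  any \<open>H(\<lambda>)\<close> with \<open>\<lambda>\<close> regular uncountable.  Hence a collection of sets, such as \<open>H(\<kappa>)\<close> or
  \<open>lift A \<kappa>\<close>, is a HOL set over the universe, and whether it is an element of the universe is a
  matter of membership in the range of \<open>elts\<close>.
\<close>

class set_universe =
  fixes elts :: "'a \<Rightarrow> 'a set"
  assumes extensionality: "elts x = elts y \<Longrightarrow> x = y"
    and foundation: "wf {(x, y). x \<in> elts y}"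
    and pairing: "\<exists>z. elts z = {x, y}"
    and union: "\<exists>u. elts u = (\<Union>y\<in>elts x. elts y)"
    and infinity: "\<exists>x. infinite (elts x)"
    and separation: "B \<subseteq> elts x \<Longrightarrow> \<exists>y. elts y = B"
    and replacement: "\<exists>y. elts y = f ` elts x"

definition vset :: "'v::set_universe set \<Rightarrow> 'v"
  where "vset B = (THE b. elts b = B)"

definition pair :: "'v::set_universe \<Rightarrow> 'v \<Rightarrow> 'v"
  where "pair a b = vset {vset {a}, vset {a, b}}"

subsection \<open>Von Neumann ordinals and cardinals\<close>

text \<open>For ordinals, \<open>\<alpha> < \<beta>\<close> is \<open>\<alpha> \<in> elts \<beta>\<close> and \<open>\<alpha> \<le> \<beta>\<close> is \<open>elts \<alpha> \<subseteq> elts \<beta>\<close>.\<close>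

definition transitive :: "'v::set_universe \<Rightarrow> bool"
  where "transitive x \<longleftrightarrow> (\<forall>y\<in>elts x. elts y \<subseteq> elts x)"

definition Ord :: "'v::set_universe \<Rightarrow> bool"
  where "Ord \<alpha> \<longleftrightarrow> transitive \<alpha> \<and> (\<forall>\<beta>\<in>elts \<alpha>. transitive \<beta>)"

definition succ :: "'v::set_universe \<Rightarrow> 'v"
  where "succ \<alpha> = vset (insert \<alpha> (elts \<alpha>))"

definition Limit :: "'v::set_universe \<Rightarrow> bool"
  where "Limit \<alpha> \<longleftrightarrow> Ord \<alpha> \<and> elts \<alpha> \<noteq> {} \<and> (\<forall>\<beta>\<in>elts \<alpha>. \<exists>\<gamma>\<in>elts \<alpha>. \<beta> \<in> elts \<gamma>)"

text \<open>The supremum of a set of ordinals is its union; in particular the supremum of the empty set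
  is \<open>0\<close>.\<close>

definition osup :: "'v::set_universe set \<Rightarrow> 'v"
  where "osup B = vset (\<Union>\<beta>\<in>B. elts \<beta>)"

definition Card :: "'v::set_universe \<Rightarrow> bool"
  where "Card \<kappa> \<longleftrightarrow> Ord \<kappa> \<and> (\<forall>\<alpha>\<in>elts \<kappa>. \<not> elts \<alpha> \<approx> elts \<kappa>)"

definition omega :: "'v::set_universe"
  where "omega = (THE \<alpha>. Limit \<alpha> \<and> (\<forall>\<beta>\<in>elts \<alpha>. \<not> Limit \<beta>))"

definition omega1 :: "'v::set_universe"
  where "omega1 = (THE \<alpha>. Ord \<alpha> \<and> uncountable (elts \<alpha>) \<and> (\<forall>\<beta>\<in>elts \<alpha>. countable (elts \<beta>)))"

definition unbounded_in :: "'v::set_universe set \<Rightarrow> 'v \<Rightarrow> bool"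
  where "unbounded_in B \<delta> \<longleftrightarrow> B \<subseteq> elts \<delta> \<and> (\<forall>\<alpha>\<in>elts \<delta>. \<exists>\<beta>\<in>B. elts \<alpha> \<subseteq> elts \<beta>)"

definition cf :: "'v::set_universe \<Rightarrow> 'v"
  where "cf \<delta> = (THE \<beta>. Ord \<beta> \<and> (\<exists>f. unbounded_in (f ` elts \<beta>) \<delta>) \<and>
                        (\<forall>\<gamma>\<in>elts \<beta>. \<nexists>f. unbounded_in (f ` elts \<gamma>) \<delta>))"

definition regular_card :: "'v::set_universe \<Rightarrow> bool"
  where "regular_card \<kappa> \<longleftrightarrow> Card \<kappa> \<and> infinite (elts \<kappa>) \<and> cf \<kappa> = \<kappa>"

definition cof_omega :: "'v::set_universe \<Rightarrow> 'v set"
  where "cof_omega \<kappa> = {\<alpha> \<in> elts \<kappa>. cf \<alpha> = omega}"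

subsection \<open>Stationary sets\<close>

definition club_in :: "'v::set_universe set \<Rightarrow> 'v \<Rightarrow> bool"
  where "club_in C \<delta> \<longleftrightarrow> unbounded_in C \<delta> \<and>
           (\<forall>\<alpha>\<in>elts \<delta>. Limit \<alpha> \<and> unbounded_in (C \<inter> elts \<alpha>) \<alpha> \<longrightarrow> \<alpha> \<in> C)"

definition stationary_in :: "'v::set_universe set \<Rightarrow> 'v \<Rightarrow> bool"
  where "stationary_in A \<delta> \<longleftrightarrow> A \<subseteq> elts \<delta> \<and> (\<forall>C. club_in C \<delta> \<longrightarrow> A \<inter> C \<noteq> {})"

text \<open>
  Stationarity of a collection of subsets of \<open>Y\<close>, via closure under finitary functions on \<open>Y\<close>.
  It is only used for collections of sets \<open>x\<close> of size \<open>\<omega>\<^sub>1\<close> with \<open>\<omega>\<^sub>1 \<subseteq> x\<close>; for these it agrees with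
  meeting every subset of \<open>[Y]\<^bsup>\<omega>1\<^esup>\<close> that is \<open>\<subseteq>\<close>-unbounded and closed under unions of nonempty
  chains of length at most \<open>\<omega>\<^sub>1\<close>.
\<close>

definition stationary_over :: "'v::set_universe set \<Rightarrow> 'v set \<Rightarrow> bool"
  where "stationary_over \<X> Y \<longleftrightarrow>
           (\<forall>f \<in> lists Y \<rightarrow> Y. \<exists>x\<in>\<X>. elts x \<subseteq> Y \<and> (\<forall>as \<in> lists (elts x). f as \<in> elts x))"

subsection \<open>Hereditary cardinality and lifting\<close>

definition trcl :: "'v::set_universe \<Rightarrow> 'v set"
  where "trcl x = {y. (y, x) \<in> {(u, v). u \<in> elts v}\<^sup>+}"

definition H :: "'v::set_universe \<Rightarrow> 'v set"
  where "H \<kappa> = {x. trcl x \<prec> elts \<kappa>}"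

definition countable_subsets :: "'v::set_universe set \<Rightarrow> 'v set"
  where "countable_subsets Y = {x. elts x \<subseteq> Y \<and> countable (elts x)}"

definition omega1_subsets :: "'v::set_universe set \<Rightarrow> 'v set"
  where "omega1_subsets Y = {x. elts x \<subseteq> Y \<and> elts x \<approx> elts (omega1 :: 'v)}"

definition lift :: "'v::set_universe \<Rightarrow> 'v \<Rightarrow> 'v set"
  where "lift A \<kappa> = {x \<in> countable_subsets (H \<kappa>). osup (elts x \<inter> elts \<kappa>) \<in> elts A}"

subsection \<open>Exact diagonal chains and reflection\<close>

text \<open>
  A collection \<open>\<S>\<close> of subsets of \<open>[H(\<kappa>)]\<^bsup>\<omega>\<^esup>\<close> is given by the extensions of its members, so that
  \<open>S \<in> X \<inter> \<S>\<close> reads \<open>S \<in> elts X\<close> and \<open>elts S \<in> \<S>\<close>, and \<open>\<S> \<subseteq> H(\<theta>)\<close> reads \<open>\<S> \<subseteq> elts ` H \<theta>\<close>.  Only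
  the values of \<open>Q\<close> at countable ordinals matter.
\<close>

definition exact_diagonal_chain ::
  "'v::set_universe \<Rightarrow> 'v set set \<Rightarrow> 'v \<Rightarrow> ('v \<Rightarrow> 'v) \<Rightarrow> bool"
  where "exact_diagonal_chain \<kappa> \<S> X Q \<longleftrightarrow>
     (\<forall>i\<in>elts omega1. Q i \<in> countable_subsets (H \<kappa>)) \<and>
     (\<forall>i\<in>elts omega1. Q i \<in> elts (Q (succ i))) \<and>
     (\<forall>l\<in>elts omega1. Limit l \<longrightarrow> elts (Q l) = (\<Union>i\<in>elts l. elts (Q i))) \<and>
     (\<forall>S\<in>elts X. elts S \<in> \<S> \<longrightarrow> stationary_in {i \<in> elts omega1. Q i \<in> elts S} omega1) \<and>
     H \<kappa> \<inter> elts X = (\<Union>i\<in>elts omega1. elts (Q i)) \<and>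
     (\<forall>\<alpha>\<in>elts omega1. vset ((\<lambda>i. pair i (Q i)) ` elts \<alpha>) \<in> H \<kappa> \<inter> elts X) \<and>
     (\<forall>i\<in>elts omega1. \<exists>S\<in>elts X. elts S \<in> \<S> \<and> Q i \<in> elts S)"

text \<open>
  The principle does not depend on which regular \<open>\<theta>\<close> with \<open>\<S> \<subseteq> H(\<theta>)\<close> is chosen; it is stated here
  with an existential quantifier.
\<close>

definition eDSRP :: "'v::set_universe \<Rightarrow> 'v set set \<Rightarrow> bool"
  where "eDSRP \<kappa> \<S> \<longleftrightarrow>
     (\<exists>\<theta>. regular_card \<theta> \<and> \<S> \<subseteq> elts ` H \<theta> \<and>
          stationary_over
            {X \<in> omega1_subsets (H \<theta>).
               elts omega1 \<subseteq> elts X \<and> (\<exists>Q. exact_diagonal_chain \<kappa> \<S> X Q)}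
            (H \<theta>))"

definition reflection_point :: "'v::set_universe \<Rightarrow> 'v \<Rightarrow> 'v \<Rightarrow> bool"
  where "reflection_point \<kappa> A \<rho> \<longleftrightarrow>
     \<rho> \<in> elts \<kappa> \<and> omega \<in> elts (cf \<rho>) \<and> stationary_in (elts A \<inter> elts \<rho>) \<rho>"

definition exact_simultaneous_reflection_point ::
  "'v::set_universe \<Rightarrow> 'v set \<Rightarrow> 'v \<Rightarrow> bool"
  where "exact_simultaneous_reflection_point \<kappa> \<A> \<rho> \<longleftrightarrow>
     \<rho> \<in> elts \<kappa> \<and> omega \<in> elts (cf \<rho>) \<and>
     (\<forall>A\<in>\<A>. reflection_point \<kappa> A \<rho>) \<and>
     (\<exists>C. club_in C \<rho> \<and> C \<subseteq> (\<Union>A\<in>\<A>. elts A) \<inter> elts \<rho>)"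

end

theory Submission
  imports Defs
begin

text \<open>
  Let \<open>X\<close> carry an exact diagonal chain \<open>Q\<close> and be closed under a few simple functions, and put
  \<open>R i = sup (Q i \<inter> \<kappa>)\<close> and \<open>\<rho> = sup (X \<inter> \<kappa>)\<close>.  Since \<open>\<kappa> \<subseteq> H(\<kappa>)\<close> and the \<open>Q i\<close> exhaust
  \<open>X \<inter> H(\<kappa>)\<close>, the ordinals \<open>R i\<close> have supremum \<open>\<rho>\<close>, and each of them is below \<open>\<rho>\<close> because
  \<open>Q i \<in> X\<close> gives \<open>R i + 1 \<in> X\<close>.  At limits \<open>R\<close> is continuous.  A continuous cofinal sequence of
  length \<open>\<omega>\<^sub>1\<close> transports club and stationary sets between \<open>\<omega>\<^sub>1\<close> and \<open>\<rho>\<close>: \<open>\<rho>\<close> has uncountable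
  cofinality (\<open>omega_mem_cf\<close>), the values of \<open>R\<close> at limits form a club in \<open>\<rho>\<close>
  (\<open>limit_values_club\<close>), and if \<open>R i \<in> A\<close> for stationarily many \<open>i\<close> then \<open>A \<inter> \<rho>\<close> is stationary
  in \<open>\<rho>\<close> (\<open>stationary_pushforward\<close>).  By definition of the lift, \<open>Q i \<in> lift A \<kappa>\<close> implies
  \<open>R i \<in> A\<close>.  So the stationarity clause for the chain makes \<open>\<rho>\<close> a reflection point of every
  stationary \<open>A \<subseteq> E\<close> in \<open>X\<close>, and the exactness clause puts every \<open>R i\<close> into one of these \<open>A\<close>,
  hence the club of limit values into their union (\<open>exact_reflection_of_chain\<close>).

  The set \<open>X\<close> is taken from a stationary collection over some \<open>H(\<theta>')\<close>, whereas the conclusion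
  concerns \<open>H(\<theta>)\<close>, where \<open>\<theta>'\<close> may be smaller or larger than \<open>\<theta>\<close>.  Given \<open>f\<close> on \<open>H(\<theta>)\<close>,
  let \<open>W\<close> be the closure of \<open>X \<inter> H(\<theta>)\<close> under \<open>f\<close>.  All members of such closures are values of a single finitary function \<open>g\<close>
  (\<open>closure_as_image\<close>), so if \<open>X\<close> is closed under those values of \<open>g\<close> that lie in \<open>H(\<theta>')\<close>, then
  \<open>W \<inter> H(\<theta>') \<subseteq> X\<close>.  As \<open>\<S>\<close> is contained in both \<open>H(\<theta>)\<close> and \<open>H(\<theta>')\<close>, \<open>\<kappa>\<close> is smaller than both
  \<open>\<theta>\<close> and \<open>\<theta>'\<close> (\<open>lesspoll_of_lift_in_H\<close>); hence \<open>W\<close> and \<open>X\<close> contain the same ordinals below \<open>\<kappa>\<close>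
  and the same subsets of \<open>\<kappa>\<close>, and the statement about \<open>X\<close> is one about \<open>W\<close>.

  The constants \<open>omega\<close>, \<open>omega1\<close> and \<open>cf\<close> are definite descriptions, so the objects have to be shown
  to exist.  For \<open>omega1\<close> this comes from the set \<open>E\<close>: an element of cofinality \<open>\<omega>\<close> below \<open>\<kappa>\<close> makes
  the cardinal \<open>\<kappa>\<close> uncountable (\<open>uncountable_if_cof_omega\<close>).
\<close>

section \<open>Sets\<close>

text \<open>
  On any other collection \<open>vset\<close> has an unspecified value.
\<close>

definition small :: "'v::set_universe set \<Rightarrow> bool"
  where "small B \<longleftrightarrow> (\<exists>x. elts x = B)"

lemma small_elts [simp]: "small (elts x)"
  by (auto simp: small_def)

lemma vset_elts [simp]: "vset (elts x) = (x :: 'v::set_universe)"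
  unfolding vset_def by (rule the_equality) (auto intro: extensionality)

lemma elts_vset [simp]: "small B \<Longrightarrow> elts (vset B) = B"
  by (auto simp: small_def)

lemma small_subset: "small B \<Longrightarrow> A \<subseteq> B \<Longrightarrow> small A"
  using separation by (auto simp: small_def)

lemma small_image: "small B \<Longrightarrow> small ((f :: 'v::set_universe \<Rightarrow> 'v) ` B)"
  using replacement by (auto simp: small_def)

lemma small_lepoll: "(A :: 'v::set_universe set) \<lesssim> (B :: 'v set) \<Longrightarrow> small B \<Longrightarrow> small A"
  unfolding lepoll_iff by (blast intro: small_subset small_image)

lemma small_pair [simp]: "small {x, y}"
  unfolding small_def by (rule pairing)

lemma small_UN: "small B \<Longrightarrow> small (\<Union>x\<in>B. elts x)"
  using union by (auto simp: small_def)

lemma small_insert [simp]: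
  assumes "small (B :: 'v::set_universe set)" shows "small (insert a B)"
proof -
  have "insert a B = (\<Union>x\<in>{vset {a, a}, vset B}. elts x)"
    using assms elts_vset[OF small_pair, of a a] by simp
  then show ?thesis
    by (metis small_UN small_pair)
qed

text \<open>
  Choice maps an infinite set of the universe onto \<open>nat\<close>, so replacement turns every countable
  collection into a set.
\<close>

lemma small_countable:
  assumes "countable (B :: 'v::set_universe set)" shows "small B"
proof -
  obtain x :: 'v where "infinite (elts x)"
    using infinity by blast
  then have "(UNIV :: nat set) \<lesssim> elts x"
    using infinite_le_lepoll by blast
  moreover have "B \<lesssim> (UNIV :: nat set)"
    using assms by (auto simp: countable_def lepoll_def)
  ultimately show ?thesis
    by (meson lepoll_trans small_elts small_lepoll)
qed

lemma exists_mem_minimal: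
  assumes "b \<in> B"
  obtains m where "m \<in> B" "\<And>y :: 'v::set_universe. y \<in> elts m \<Longrightarrow> y \<notin> B"
  using wfE_min[OF foundation, of b B] assms by auto

lemma mem_irrefl [simp]: "x \<notin> elts (x :: 'v::set_universe)"
  by (rule exists_mem_minimal[of x "{x}"]) auto


section \<open>Ordinals\<close>

lemma Ord_mem: "Ord \<alpha> \<Longrightarrow> \<beta> \<in> elts \<alpha> \<Longrightarrow> Ord \<beta>"
  unfolding Ord_def transitive_def by blast

lemma Ord_trans: "Ord \<alpha> \<Longrightarrow> \<beta> \<in> elts \<alpha> \<Longrightarrow> \<gamma> \<in> elts \<beta> \<Longrightarrow> \<gamma> \<in> elts \<alpha>"
  by (auto simp: Ord_def transitive_def)

lemma OrdI: "(\<And>\<beta>. \<beta> \<in> elts \<alpha> \<Longrightarrow> Ord \<beta> \<and> elts \<beta> \<subseteq> elts \<alpha>) \<Longrightarrow> Ord \<alpha>"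
  by (auto simp: Ord_def transitive_def)

lemma mem_induct:
  assumes "\<And>x :: 'v::set_universe. (\<And>y. y \<in> elts x \<Longrightarrow> P y) \<Longrightarrow> P x" shows "P x"
  by (rule wf_induct_rule[OF foundation]) (use assms in auto)

text \<open>
  By a double \<open>\<in>\<close>-induction: if \<open>\<alpha>\<close> and \<open>\<beta>\<close> were incomparable, then, all elements of the one being
  comparable with the other, each would be a subset of the other.
\<close>

lemma Ord_linear:
  assumes "Ord \<alpha>" "Ord (\<beta> :: 'v::set_universe)"
  shows "\<alpha> \<in> elts \<beta> \<or> \<alpha> = \<beta> \<or> \<beta> \<in> elts \<alpha>"
  using assms
proof (induction \<alpha> arbitrary: \<beta> rule: mem_induct)
  case (1 \<alpha>)
  note IH\<alpha> = 1
  show ?case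
    using \<open>Ord \<beta>\<close>
  proof (induction \<beta> rule: mem_induct)
    case (1 \<beta>)
    show ?case
    proof (rule ccontr)
      assume *: "\<not> ?case"
      have "elts \<alpha> \<subseteq> elts \<beta>"
        using IH\<alpha> 1 * by (metis Ord_mem Ord_trans subsetI)
      moreover have "elts \<beta> \<subseteq> elts \<alpha>"
        using IH\<alpha> 1 * by (metis Ord_mem Ord_trans subsetI)
      ultimately show False
        using * extensionality by blast
    qed
  qed
qed

lemma Ord_subset_iff:
  assumes "Ord \<alpha>" "Ord (\<beta> :: 'v::set_universe)"
  shows "elts \<alpha> \<subseteq> elts \<beta> \<longleftrightarrow> \<alpha> \<in> elts \<beta> \<or> \<alpha> = \<beta>"
  using assms Ord_linear Ord_trans by (metis mem_irrefl subsetD subsetI)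

lemma Ord_not_subset:
  assumes "Ord \<alpha>" "Ord (\<beta> :: 'v::set_universe)" "\<not> elts \<alpha> \<subseteq> elts \<beta>"
  shows "\<beta> \<in> elts \<alpha>"
  using assms Ord_linear Ord_subset_iff by blast

lemma Ord_subset_mem:
  assumes "Ord \<alpha>" "Ord (\<gamma> :: 'v::set_universe)" "elts \<alpha> \<subseteq> elts \<beta>" "\<beta> \<in> elts \<gamma>"
  shows "\<alpha> \<in> elts \<gamma>"
  using assms by (metis Ord_mem Ord_subset_iff Ord_trans)

lemma elts_succ [simp]: "elts (succ \<alpha>) = insert (\<alpha> :: 'v::set_universe) (elts \<alpha>)"
  by (simp add: succ_def)

lemma Ord_succ: "Ord \<alpha> \<Longrightarrow> Ord (succ \<alpha> :: 'v::set_universe)"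
  by (rule OrdI) (auto intro: Ord_mem Ord_trans)

lemma elts_osup: "small B \<Longrightarrow> elts (osup B) = (\<Union>\<beta>\<in>B. elts \<beta>)"
  by (simp add: osup_def small_UN)

lemma Ord_osup:
  assumes "small B" "\<And>\<beta>. \<beta> \<in> B \<Longrightarrow> Ord (\<beta> :: 'v::set_universe)" shows "Ord (osup B)"
  by (rule OrdI) (use assms in \<open>auto simp: elts_osup intro: Ord_mem Ord_trans\<close>)

lemma ex1_least_Ord:
  assumes "Ord (\<alpha> :: 'v::set_universe)" "P \<alpha>"
  shows "\<exists>!\<beta>. Ord \<beta> \<and> P \<beta> \<and> (\<forall>\<gamma>\<in>elts \<beta>. \<not> P \<gamma>)"
proof -
  obtain m where "m \<in> {\<beta>. Ord \<beta> \<and> P \<beta>}" "\<And>y. y \<in> elts m \<Longrightarrow> y \<notin> {\<beta>. Ord \<beta> \<and> P \<beta>}"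
    using assms exists_mem_minimal[of \<alpha> "{\<beta>. Ord \<beta> \<and> P \<beta>}"] by auto
  then show ?thesis
    by (metis (mono_tags, lifting) Ord_linear Ord_mem mem_Collect_eq)
qed

lemma Limit_Ord: "Limit \<alpha> \<Longrightarrow> Ord \<alpha>"
  by (simp add: Limit_def)

lemma LimitE:
  assumes "Limit \<alpha>" "\<beta> \<in> elts \<alpha>" obtains \<gamma> where "\<gamma> \<in> elts \<alpha>" "\<beta> \<in> elts \<gamma>"
  using assms by (auto simp: Limit_def)

text \<open>
  In a finite ordinal some element \<open>\<beta>\<close> has the largest number of elements, and an element above
  \<open>\<beta>\<close> would have more.
\<close>

lemma infinite_Limit:
  assumes "Limit (\<alpha> :: 'v::set_universe)" shows "infinite (elts \<alpha>)"
proof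
  assume fin: "finite (elts \<alpha>)"
  have "elts \<alpha> \<noteq> {}"
    using assms by (simp add: Limit_def)
  then have "Max ((\<lambda>\<gamma>. card (elts \<gamma>)) ` elts \<alpha>) \<in> (\<lambda>\<gamma>. card (elts \<gamma>)) ` elts \<alpha>"
    using fin by (intro Max_in) auto
  then obtain \<beta> where \<beta>: "\<beta> \<in> elts \<alpha>"
    "card (elts \<beta>) = Max ((\<lambda>\<gamma>. card (elts \<gamma>)) ` elts \<alpha>)"
    by auto
  obtain \<gamma> where \<gamma>: "\<gamma> \<in> elts \<alpha>" "\<beta> \<in> elts \<gamma>"
    using assms \<beta> LimitE by blast
  have "Ord \<alpha>"
    using assms by (simp add: Limit_def)
  then have "elts \<beta> \<subseteq> elts \<gamma>" "finite (elts \<gamma>)"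
    using \<gamma> fin by (auto intro: Ord_mem Ord_trans finite_subset)
  moreover have "elts \<beta> \<noteq> elts \<gamma>"
    using \<gamma>(2) mem_irrefl by metis
  ultimately have "card (elts \<beta>) < card (elts \<gamma>)"
    by (simp add: psubset_card_mono psubset_eq)
  moreover have "card (elts \<gamma>) \<le> card (elts \<beta>)"
    unfolding \<beta>(2) using fin \<gamma> by (intro Max_ge) auto
  ultimately show False
    by simp
qed

text \<open>
  The finite ordinals form a countable, hence small, set; it is a limit ordinal, so that a least
  limit ordinal exists and is contained in it.
\<close>

lemma omega: "Limit (omega :: 'v::set_universe)" "countable (elts (omega :: 'v))"
proof -
  define s where "s = rec_nat (vset {} :: 'v) (\<lambda>_. succ)"
  have s: "elts (s 0) = {}" "elts (s (Suc n)) = insert (s n) (elts (s n))" for n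
    by (simp_all add: s_def small_countable)
  have sub: "elts (s n) \<subseteq> range s" and ord: "Ord (s n)" for n
    by (induction n) (auto simp: s intro: OrdI, simp add: s_def Ord_succ)
  define w where "w = vset (range s)"
  have w: "elts w = range s"
    by (simp add: w_def small_countable)
  have "Ord w"
    by (rule OrdI) (use w sub ord in auto)
  moreover have "s n \<in> elts (s (Suc n))" for n
    by (simp add: s)
  ultimately have "Limit w"
    unfolding Limit_def w by blast
  then have "Ord w"
    by (simp add: Limit_def)
  have "\<exists>!\<alpha> :: 'v. Limit \<alpha> \<and> (\<forall>\<beta>\<in>elts \<alpha>. \<not> Limit \<beta>)"
    using ex1_least_Ord[of w Limit] \<open>Limit w\<close> \<open>Ord w\<close> by (auto simp: Limit_def)
  then have *: "Limit (omega :: 'v) \<and> (\<forall>\<beta>\<in>elts (omega :: 'v). \<not> Limit \<beta>)"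
    unfolding omega_def by (rule theI')
  then show "Limit (omega :: 'v)"
    by simp
  then have "elts omega \<subseteq> elts w"
    using * \<open>Limit w\<close> \<open>Ord w\<close> Ord_not_subset Limit_Ord by blast
  then show "countable (elts (omega :: 'v))"
    unfolding w by (rule countable_subset) simp
qed

lemma Ord_omega: "Ord omega"
  by (rule Limit_Ord[OF omega(1)])

lemma unbounded_in_self: "unbounded_in (elts \<delta>) \<delta>"
  by (auto simp: unbounded_in_def)

lemma cf:
  assumes "Ord (\<delta> :: 'v::set_universe)"
  shows "Ord (cf \<delta>)" "\<exists>f. unbounded_in (f ` elts (cf \<delta>)) \<delta>"
    "\<gamma> \<in> elts (cf \<delta>) \<Longrightarrow> \<not> unbounded_in (f ` elts \<gamma>) \<delta>" "elts (cf \<delta>) \<subseteq> elts \<delta>"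
proof -
  have ex: "\<exists>f. unbounded_in (f ` elts \<delta>) \<delta>"
    using unbounded_in_self[of \<delta>] by (metis image_ident)
  have *: "Ord (cf \<delta>) \<and> (\<exists>f. unbounded_in (f ` elts (cf \<delta>)) \<delta>) \<and>
          (\<forall>\<gamma>\<in>elts (cf \<delta>). \<nexists>f. unbounded_in (f ` elts \<gamma>) \<delta>)"
    unfolding cf_def
    by (rule theI', rule ex1_least_Ord[of \<delta>]) (use assms ex in auto)
  then show "Ord (cf \<delta>)" "\<exists>f. unbounded_in (f ` elts (cf \<delta>)) \<delta>"
    "\<gamma> \<in> elts (cf \<delta>) \<Longrightarrow> \<not> unbounded_in (f ` elts \<gamma>) \<delta>"
    by auto
  show "elts (cf \<delta>) \<subseteq> elts \<delta>"
    using * assms ex Ord_not_subset by blast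
qed

text \<open>
  A subset of \<open>\<kappa>\<close> that is an image of some \<open>\<gamma> < \<kappa>\<close> is not unbounded, as \<open>\<gamma> < cf \<kappa>\<close>.
\<close>

lemma osup_mem_regular_card:
  assumes "regular_card \<kappa>" "\<gamma> \<in> elts \<kappa>" "B \<lesssim> elts \<gamma>" "B \<subseteq> elts (\<kappa> :: 'v::set_universe)"
  shows "osup B \<in> elts \<kappa>"
proof -
  have \<kappa>: "Ord \<kappa>" "cf \<kappa> = \<kappa>"
    using assms(1) by (auto simp: regular_card_def Card_def)
  have small: "small B"
    using assms(4) small_elts small_subset by blast
  have "\<not> unbounded_in B \<kappa>"
  proof (cases "B = {}")
    case True
    then show ?thesis
      using assms(2) by (auto simp: unbounded_in_def)
  next
    case False
    then obtain f where "f ` elts \<gamma> = B"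
      using assms(3) by (metis empty_lepoll lepoll_def lepoll_empty_iff_empty image_is_empty inj_on_iff_surj)
    then show ?thesis
      using cf(3)[of \<kappa> \<gamma> f] \<kappa> assms(2) by auto
  qed
  then obtain \<alpha> where \<alpha>: "\<alpha> \<in> elts \<kappa>" "\<And>\<beta>. \<beta> \<in> B \<Longrightarrow> \<not> elts \<alpha> \<subseteq> elts \<beta>"
    using assms(4) by (auto simp: unbounded_in_def)
  have "elts (osup B) \<subseteq> elts \<alpha>"
  proof -
    have "\<beta> \<in> elts \<alpha>" if "\<beta> \<in> B" for \<beta>
      using that \<alpha> assms(4) \<kappa>(1) Ord_mem Ord_not_subset by blast
    moreover have "Ord \<alpha>"
      using \<alpha>(1) \<kappa>(1) Ord_mem by blast
    ultimately show ?thesis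
      unfolding elts_osup[OF small] using Ord_trans by blast
  qed
  moreover have "Ord (osup B)"
    by (rule Ord_osup) (use small assms(4) \<kappa>(1) Ord_mem in blast)+
  ultimately show ?thesis
    using \<alpha>(1) \<kappa>(1) Ord_subset_mem by blast
qed


section \<open>The first uncountable ordinal\<close>

definition first_uncountable :: "'v::set_universe \<Rightarrow> bool"
  where "first_uncountable w \<longleftrightarrow>
           Ord w \<and> uncountable (elts w) \<and> (\<forall>\<beta>\<in>elts w. countable (elts \<beta>))"

text \<open>
  Some uncountable ordinal has to be given: in a universe without power sets all sets may be
  countable, and then \<open>omega1\<close> describes nothing.
\<close>

lemma first_uncountable_omega1:
  assumes "Ord (\<alpha> :: 'v::set_universe)" "uncountable (elts \<alpha>)"
  shows "first_uncountable (omega1 :: 'v)"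
proof -
  have "\<exists>!\<beta> :: 'v. Ord \<beta> \<and> uncountable (elts \<beta>) \<and> (\<forall>\<gamma>\<in>elts \<beta>. \<not> uncountable (elts \<gamma>))"
    by (rule ex1_least_Ord[of \<alpha>]) (use assms in auto)
  then show ?thesis
    unfolding first_uncountable_def omega1_def not_not by (rule theI')
qed

text \<open>
  Since \<open>cf \<epsilon> \<le> \<epsilon>\<close>, the hypothesis gives \<open>\<omega> < \<kappa>\<close>, and a countable \<open>\<kappa>\<close> would then be equinumerous
  with its element \<open>\<omega>\<close>.
\<close>

lemma uncountable_if_cof_omega:
  assumes "Card \<kappa>" "\<epsilon> \<in> elts \<kappa>" "cf \<epsilon> = (omega :: 'v::set_universe)"
  shows "uncountable (elts \<kappa>)"
proof
  assume count: "countable (elts \<kappa>)"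
  have \<kappa>: "Ord \<kappa>" "\<And>\<alpha>. \<alpha> \<in> elts \<kappa> \<Longrightarrow> \<not> elts \<alpha> \<approx> elts \<kappa>"
    using assms(1) by (auto simp: Card_def)
  have "elts (omega :: 'v) \<subseteq> elts \<epsilon>"
    using cf(4)[of \<epsilon>] assms(2,3) \<kappa>(1) Ord_mem by metis
  then have mem: "(omega :: 'v) \<in> elts \<kappa>"
    using \<kappa>(1) assms(2) Ord_omega Ord_subset_mem by blast
  then have "elts (omega :: 'v) \<subseteq> elts \<kappa>"
    using \<kappa>(1) Ord_trans by blast
  moreover have "infinite (elts (omega :: 'v))"
    by (rule infinite_Limit[OF omega(1)])
  then have "elts \<kappa> \<lesssim> elts (omega :: 'v)"
    using count by (meson countableE_infinite countable_def infinite_le_lepoll inj_on_def lepoll_def lepoll_trans subset_UNIV)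
  ultimately have "elts (omega :: 'v) \<approx> elts \<kappa>"
    by (simp add: lepoll_antisym subset_imp_lepoll)
  then show False
    using \<kappa>(2) mem by blast
qed

text \<open>
  The bound is the supremum of the successors: it is a countable ordinal, being a countable union
  of countable sets.
\<close>

lemma countable_subset_bounded:
  assumes w: "first_uncountable (w :: 'v::set_universe)" and B: "B \<subseteq> elts w" "countable B"
  obtains \<beta> where "\<beta> \<in> elts w" "B \<subseteq> elts \<beta>"
proof -
  have Ow: "Ord w"
    using w by (simp add: first_uncountable_def)
  have count: "countable (succ ` B)"
    using B(2) by simp
  have eq: "elts (osup (succ ` B)) = (\<Union>\<beta>\<in>B. insert \<beta> (elts \<beta>))"
    by (simp add: elts_osup small_countable[OF count])
  have "countable (elts (osup (succ ` B)))"
    unfolding eq using B(2)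
    by (rule countable_UN) (use w B(1) in \<open>auto simp: first_uncountable_def\<close>)
  then have "\<not> elts w \<subseteq> elts (osup (succ ` B))"
    using w countable_subset by (auto simp: first_uncountable_def)
  moreover have "Ord (osup (succ ` B))"
    by (rule Ord_osup[OF small_countable[OF count]]) (use B(1) Ow Ord_mem Ord_succ in blast)
  ultimately have "osup (succ ` B) \<in> elts w"
    using Ow Ord_not_subset by blast
  then show thesis
    by (rule that) (auto simp: eq)
qed

text \<open>
  A closure point above \<open>a\<close> is the supremum of an \<open>\<omega>\<close>-sequence starting at \<open>a\<close>, each term of which
  bounds the previous one together with the values of \<open>g\<close> on it.
\<close>

lemma closure_points_club:
  assumes w: "first_uncountable (w :: 'v::set_universe)" and g: "\<And>j. j \<in> elts w \<Longrightarrow> g j \<in> elts w"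
  shows "club_in {i \<in> elts w. Limit i \<and> (\<forall>j\<in>elts i. g j \<in> elts i)} w"
proof -
  let ?C = "{i \<in> elts w. Limit i \<and> (\<forall>j\<in>elts i. g j \<in> elts i)}"
  have Ow: "Ord w"
    using w by (simp add: first_uncountable_def)
  have "\<exists>i\<in>?C. elts a \<subseteq> elts i" if a: "a \<in> elts w" for a
  proof -
    have "\<exists>b\<in>elts w. c \<in> elts b \<and> (\<forall>j\<in>elts c. g j \<in> elts b)" if c: "c \<in> elts w" for c
    proof -
      have "insert c (g ` elts c) \<subseteq> elts w"
        using c g Ow Ord_trans by blast
      moreover have "countable (insert c (g ` elts c))"
        using c w by (auto simp: first_uncountable_def)
      ultimately obtain b where "b \<in> elts w" "insert c (g ` elts c) \<subseteq> elts b"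
        using countable_subset_bounded[OF w] by metis
      then show ?thesis
        by auto
    qed
    then obtain h where h: "\<And>c. c \<in> elts w \<Longrightarrow> h c \<in> elts w"
      "\<And>c. c \<in> elts w \<Longrightarrow> c \<in> elts (h c)"
      "\<And>c j. c \<in> elts w \<Longrightarrow> j \<in> elts c \<Longrightarrow> g j \<in> elts (h c)"
      by metis
    define s where "s = rec_nat a (\<lambda>_. h)"
    have s_simps: "s 0 = a" "s (Suc n) = h (s n)" for n
      by (simp_all add: s_def)
    have s: "s n \<in> elts w" for n
      by (induction n) (simp_all add: s_simps a h)
    have sub: "range s \<subseteq> elts w" and small: "small (range s)"
      using s by (auto intro: small_countable)
    define i where "i = osup (range s)"
    have i: "elts i = (\<Union>n. elts (s n))"
      using small by (simp add: i_def elts_osup)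
    have Oi: "Ord i"
      unfolding i_def by (rule Ord_osup[OF small]) (use sub Ow Ord_mem in blast)
    have si: "s n \<in> elts i" for n
      unfolding i using h(2)[OF s[of n]] s_simps(2)[of n] by (metis UN_I UNIV_I)
    obtain b where b: "b \<in> elts w" "range s \<subseteq> elts b"
      using countable_subset_bounded[OF w sub] by auto
    have "Ord b"
      using b(1) Ow Ord_mem by blast
    then have "elts i \<subseteq> elts b"
      unfolding i using b(2) Ord_trans by blast
    then have "i \<in> elts w"
      using Ord_subset_mem[OF Oi Ow] b(1) by blast
    moreover have "Limit i"
      unfolding Limit_def
    proof (intro conjI ballI)
      show "elts i \<noteq> {}"
        using si by blast
    next
      fix \<beta> assume "\<beta> \<in> elts i"
      then obtain n where "\<beta> \<in> elts (s n)"
        unfolding i by blast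
      then show "\<exists>\<gamma>\<in>elts i. \<beta> \<in> elts \<gamma>"
        using si by blast
    qed (rule Oi)
    moreover have "g j \<in> elts i" if j: "j \<in> elts i" for j
    proof -
      obtain n where "j \<in> elts (s n)"
        using j unfolding i by blast
      then have "g j \<in> elts (s (Suc n))"
        using h(3)[OF s[of n]] s_simps(2) by metis
      then show ?thesis
        unfolding i by blast
    qed
    moreover have "elts a \<subseteq> elts i"
      using s_simps(1) i by auto
    ultimately show ?thesis
      by blast
  qed
  then have "unbounded_in ?C w"
    by (auto simp: unbounded_in_def)
  moreover have "\<alpha> \<in> ?C"
    if \<alpha>: "\<alpha> \<in> elts w" and lim: "Limit \<alpha>" and unb: "unbounded_in (?C \<inter> elts \<alpha>) \<alpha>" for \<alpha>
  proof -
    have "g j \<in> elts \<alpha>" if j: "j \<in> elts \<alpha>" for j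
    proof -
      obtain \<gamma> where "\<gamma> \<in> elts \<alpha>" "j \<in> elts \<gamma>"
        using lim j LimitE by blast
      then obtain c where "c \<in> ?C" "c \<in> elts \<alpha>" "j \<in> elts c"
        using unb unfolding unbounded_in_def by blast
      then show ?thesis
        using Limit_Ord[OF lim] Ord_trans by blast
    qed
    then show ?thesis
      using \<alpha> lim by blast
  qed
  ultimately show ?thesis
    unfolding club_in_def by blast
qed

lemma Limit_above:
  assumes w: "first_uncountable (w :: 'v::set_universe)" and B: "B \<subseteq> elts w" "countable B"
  obtains l where "l \<in> elts w" "Limit l" "B \<subseteq> elts l"
proof -
  obtain \<beta> where \<beta>: "\<beta> \<in> elts w" "B \<subseteq> elts \<beta>"
    using countable_subset_bounded[OF w B] by blast
  obtain l where "l \<in> elts w" "Limit l" "elts \<beta> \<subseteq> elts l"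
    using closure_points_club[OF w, of "\<lambda>j. j"] \<beta>(1)
    unfolding club_in_def unbounded_in_def by blast
  then show thesis
    using that \<beta>(2) by blast
qed

section \<open>Continuous cofinal sequences of length \<open>\<omega>\<^sub>1\<close>\<close>

text \<open>
  Continuity makes \<open>R\<close> monotone in the form \<open>R i \<le> R l\<close> for \<open>i < l\<close> with \<open>l\<close> a limit.  Full
  monotonicity would be too much to ask of the suprema along an \<open>\<in>\<close>-chain \<open>Q\<close>, because
  \<open>Q i \<in> Q (i + 1)\<close> does not entail \<open>Q i \<subseteq> Q (i + 1)\<close>.
\<close>

definition continuous_cofinal :: "'v::set_universe \<Rightarrow> ('v \<Rightarrow> 'v) \<Rightarrow> 'v \<Rightarrow> bool"
  where "continuous_cofinal w R \<rho> \<longleftrightarrow>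
     Ord \<rho> \<and> (\<forall>i\<in>elts w. R i \<in> elts \<rho>) \<and> elts \<rho> = (\<Union>i\<in>elts w. elts (R i)) \<and>
     (\<forall>l\<in>elts w. Limit l \<longrightarrow> elts (R l) = (\<Union>i\<in>elts l. elts (R i)))"

lemma continuous_cofinalD:
  assumes "continuous_cofinal w R \<rho>"
  shows "Ord \<rho>" "i \<in> elts w \<Longrightarrow> R i \<in> elts \<rho>"
    "l \<in> elts w \<Longrightarrow> Limit l \<Longrightarrow> elts (R l) = (\<Union>i\<in>elts l. elts (R i))"
  using assms unfolding continuous_cofinal_def by blast+

text \<open>
  Choose for every element of \<open>B\<close> an index at which \<open>R\<close> exceeds it; countably many indices lie below
  a common limit \<open>l\<close>, and \<open>R l\<close> exceeds the earlier values.
\<close>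

lemma continuous_cofinal_bound:
  assumes w: "first_uncountable (w :: 'v::set_universe)" and R: "continuous_cofinal w R \<rho>"
    and B: "B \<subseteq> elts \<rho>" "countable B"
  obtains l where "l \<in> elts w" "Limit l" "B \<subseteq> elts (R l)"
proof -
  have "\<forall>b\<in>B. \<exists>i\<in>elts w. b \<in> elts (R i)"
    using R B(1) by (auto simp: continuous_cofinal_def)
  then obtain f where f: "\<And>b. b \<in> B \<Longrightarrow> f b \<in> elts w \<and> b \<in> elts (R (f b))"
    by metis
  then have "f ` B \<subseteq> elts w" "countable (f ` B)"
    using B(2) by auto
  then obtain l where l: "l \<in> elts w" "Limit l" "f ` B \<subseteq> elts l"
    by (rule Limit_above[OF w])
  moreover have "B \<subseteq> elts (R l)"
  proof
    fix b assume b: "b \<in> B"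
    have "elts (R l) = (\<Union>i\<in>elts l. elts (R i))"
      by (rule continuous_cofinalD(3)[OF R l(1,2)])
    then show "b \<in> elts (R l)"
      using f[OF b] l(3) b by blast
  qed
  ultimately show thesis
    using that by blast
qed

text \<open>
  A countable set below \<open>\<rho>\<close> is a subset of a single \<open>R l < \<rho>\<close>, hence not unbounded in \<open>\<rho>\<close>.
\<close>

lemma omega_mem_cf:
  assumes w: "first_uncountable (w :: 'v::set_universe)" and R: "continuous_cofinal w R \<rho>"
  shows "omega \<in> elts (cf \<rho>)"
proof (rule ccontr)
  assume "omega \<notin> elts (cf \<rho>)"
  have O\<rho>: "Ord \<rho>"
    by (rule continuous_cofinalD(1)[OF R])
  then have "elts (cf \<rho>) \<subseteq> elts omega"
    using \<open>omega \<notin> elts (cf \<rho>)\<close> Ord_not_subset cf(1) Ord_omega by blast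
  then have "countable (elts (cf \<rho>))"
    using omega(2) countable_subset by blast
  then obtain B where B: "unbounded_in B \<rho>" "countable B"
    using cf(2)[OF O\<rho>] by blast
  then have "B \<subseteq> elts \<rho>"
    by (simp add: unbounded_in_def)
  then obtain l where l: "l \<in> elts w" "B \<subseteq> elts (R l)"
    using continuous_cofinal_bound[OF w R _ B(2)] by metis
  then have "R l \<in> elts \<rho>"
    by (simp add: continuous_cofinalD(2)[OF R])
  then obtain \<beta> where "\<beta> \<in> B" "elts (R l) \<subseteq> elts \<beta>"
    using B(1) by (auto simp: unbounded_in_def)
  then have "\<beta> \<in> elts \<beta>"
    using l by blast
  then show False
    by simp
qed

text \<open>
  A limit \<open>\<alpha>\<close> of values of \<open>R\<close> at limits is attained at the supremum \<open>l\<close> of the limits \<open>m\<close> with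
  \<open>R m < \<alpha>\<close>: these \<open>m\<close> have no maximum, so \<open>l\<close> is a limit and continuity gives \<open>R l = \<alpha>\<close>.
\<close>

lemma limit_values_club:
  assumes w: "first_uncountable (w :: 'v::set_universe)" and R: "continuous_cofinal w R \<rho>"
  shows "club_in (R ` {l \<in> elts w. Limit l}) \<rho>"
proof -
  let ?C = "R ` {l \<in> elts w. Limit l}"
  have Ow: "Ord w"
    using w by (simp add: first_uncountable_def)
  have O\<rho>: "Ord \<rho>" and R\<rho>: "\<And>i. i \<in> elts w \<Longrightarrow> R i \<in> elts \<rho>"
    and Rl: "\<And>l. l \<in> elts w \<Longrightarrow> Limit l \<Longrightarrow> elts (R l) = (\<Union>i\<in>elts l. elts (R i))"
    using continuous_cofinalD[OF R] by blast+
  have OR: "Ord (R i)" if "i \<in> elts w" for i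
    using R\<rho>[OF that] O\<rho> Ord_mem by blast
  have "\<exists>\<beta>\<in>?C. elts \<alpha> \<subseteq> elts \<beta>" if \<alpha>: "\<alpha> \<in> elts \<rho>" for \<alpha>
  proof -
    obtain l where "l \<in> elts w" "Limit l" "\<alpha> \<in> elts (R l)"
      using continuous_cofinal_bound[OF w R, of "{\<alpha>}"] \<alpha> by auto
    then show ?thesis
      using OR Ord_trans by blast
  qed
  then have "unbounded_in ?C \<rho>"
    unfolding unbounded_in_def using R\<rho> by blast
  moreover have "\<alpha> \<in> ?C"
    if \<alpha>: "\<alpha> \<in> elts \<rho>" and lim: "Limit \<alpha>" and unb: "unbounded_in (?C \<inter> elts \<alpha>) \<alpha>" for \<alpha>
  proof -
    define M where "M = {l \<in> elts w. Limit l \<and> R l \<in> elts \<alpha>}"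
    have O\<alpha>: "Ord \<alpha>"
      by (rule Limit_Ord[OF lim])
    have M_above: "\<exists>m\<in>M. x \<in> elts (R m)" if x: "x \<in> elts \<alpha>" for x
    proof -
      obtain \<gamma> where "\<gamma> \<in> elts \<alpha>" "x \<in> elts \<gamma>"
        using lim x LimitE by blast
      then obtain \<beta> where "\<beta> \<in> ?C" "\<beta> \<in> elts \<alpha>" "x \<in> elts \<beta>"
        using unb unfolding unbounded_in_def by blast
      then show ?thesis
        unfolding M_def by blast
    qed
    have M_less: "m \<in> elts l" if m: "m \<in> M" and l: "l \<in> elts w" "Limit l" "R m \<in> elts (R l)" for m l
    proof (rule ccontr)
      assume "m \<notin> elts l"
      moreover have "Ord m" "Ord l"
        using m l Ow Ord_mem by (auto simp: M_def)
      ultimately have "l = m \<or> l \<in> elts m"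
        using Ord_linear by blast
      then have "elts (R l) \<subseteq> elts (R m)"
        using Rl[of m] m unfolding M_def by blast
      then have "R m \<in> elts (R m)"
        using l(3) by blast
      then show False
        by simp
    qed
    obtain l0 where l0: "l0 \<in> elts w" "Limit l0" "\<alpha> \<in> elts (R l0)"
      using continuous_cofinal_bound[OF w R, of "{\<alpha>}"] \<alpha> by auto
    have "M \<subseteq> elts l0"
    proof
      fix m assume m: "m \<in> M"
      then have "R m \<in> elts (R l0)"
        using l0 OR Ord_trans unfolding M_def by blast
      then show "m \<in> elts l0"
        using M_less m l0 by blast
    qed
    then have smallM: "small M"
      using small_elts small_subset by blast
    define l where "l = osup M"
    have l: "elts l = (\<Union>m\<in>M. elts m)"
      unfolding l_def by (rule elts_osup[OF smallM])
    have Ol: "Ord l"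
      unfolding l_def by (rule Ord_osup[OF smallM]) (use Ow Ord_mem M_def in blast)
    have "Ord l0"
      using l0 Limit_Ord by blast
    then have "elts l \<subseteq> elts l0"
      unfolding l using \<open>M \<subseteq> elts l0\<close> Ord_trans by blast
    then have lw: "l \<in> elts w"
      using Ord_subset_mem[OF Ol Ow] l0(1) by blast
    have M_next: "\<exists>m'\<in>M. m \<in> elts m'" if m: "m \<in> M" for m
    proof -
      have "R m \<in> elts \<alpha>"
        using m by (simp add: M_def)
      then obtain m' where "m' \<in> M" "R m \<in> elts (R m')"
        using M_above by blast
      then show ?thesis
        using M_less[OF m] unfolding M_def by blast
    qed
    have "M \<noteq> {}"
      using M_above lim by (auto simp: Limit_def)
    then have liml: "Limit l"
      unfolding Limit_def using Ol M_next unfolding l by blast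
    have "elts (R l) = elts \<alpha>"
    proof
      show "elts (R l) \<subseteq> elts \<alpha>"
      proof
        fix x assume "x \<in> elts (R l)"
        then obtain m i where "m \<in> M" "i \<in> elts m" "x \<in> elts (R i)"
          using Rl[OF lw liml] l by auto
        then have "x \<in> elts (R m)" "R m \<in> elts \<alpha>"
          using Rl[of m] by (auto simp: M_def)
        then show "x \<in> elts \<alpha>"
          using O\<alpha> Ord_trans by blast
      qed
      show "elts \<alpha> \<subseteq> elts (R l)"
        using M_above M_next Rl[OF lw liml] l by blast
    qed
    then have "R l = \<alpha>"
      by (rule extensionality)
    then show ?thesis
      using lw liml by blast
  qed
  ultimately show ?thesis
    unfolding club_in_def by blast
qed

text \<open>
  For each \<open>j\<close> choose \<open>d j \<in> D\<close> and an index \<open>k j\<close> with \<open>R j < d j < R (k j)\<close>.  At a closure point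
  \<open>i\<close> of \<open>k\<close>, the \<open>R j\<close> and the \<open>d j\<close> with \<open>j < i\<close> interleave and have the same supremum \<open>R i\<close>,
  which therefore is a limit point of \<open>D\<close>.
\<close>

lemma club_pullback:
  assumes w: "first_uncountable (w :: 'v::set_universe)" and R: "continuous_cofinal w R \<rho>"
    and D: "club_in D \<rho>"
  obtains C where "club_in C w" "R ` C \<subseteq> D"
proof -
  have O\<rho>: "Ord \<rho>" and R\<rho>: "\<And>i. i \<in> elts w \<Longrightarrow> R i \<in> elts \<rho>"
    and Rl: "\<And>l. l \<in> elts w \<Longrightarrow> Limit l \<Longrightarrow> elts (R l) = (\<Union>i\<in>elts l. elts (R i))"
    using continuous_cofinalD[OF R] by blast+
  have D\<rho>: "D \<subseteq> elts \<rho>"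
    using D by (simp add: club_in_def unbounded_in_def)
  have "\<exists>d k. d \<in> D \<and> k \<in> elts w \<and> R j \<in> elts d \<and> d \<in> elts (R k)" if j: "j \<in> elts w" for j
  proof -
    obtain l where "l \<in> elts w" "R j \<in> elts (R l)"
      using continuous_cofinal_bound[OF w R, of "{R j}"] R\<rho>[OF j] by auto
    then obtain d where d: "d \<in> D" "R j \<in> elts d"
      using D R\<rho> unfolding club_in_def unbounded_in_def by blast
    obtain k where "k \<in> elts w" "d \<in> elts (R k)"
      using continuous_cofinal_bound[OF w R, of "{d}"] d(1) D\<rho> by auto
    then show ?thesis
      using d by blast
  qed
  then obtain d k where dk: "\<And>j. j \<in> elts w \<Longrightarrow> d j \<in> D \<and> k j \<in> elts w \<and> R j \<in> elts (d j) \<and> d j \<in> elts (R (k j))"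
    by metis
  let ?C = "{i \<in> elts w. Limit i \<and> (\<forall>j\<in>elts i. k j \<in> elts i)}"
  have Ow: "Ord w"
    using w by (simp add: first_uncountable_def)
  have "R i \<in> D" if i: "i \<in> ?C" for i
  proof -
    have iw: "i \<in> elts w" and lim: "Limit i"
      using i by auto
    have Ri: "Ord (R i)"
      using R\<rho>[OF iw] O\<rho> Ord_mem by blast
    have between: "\<exists>\<beta>\<in>D \<inter> elts (R i). R j \<in> elts \<beta>" if j: "j \<in> elts i" for j
    proof -
      have "j \<in> elts w" "k j \<in> elts i"
        using j i Ow Ord_trans by blast+
      then have "d j \<in> elts (R i)"
        using dk Rl[OF iw lim] by blast
      then show ?thesis
        using dk[OF \<open>j \<in> elts w\<close>] by blast
    qed
    have below: "\<exists>j\<in>elts i. x \<in> elts (R j)" if "x \<in> elts (R i)" for x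
      using that Rl[OF iw lim] by blast
    have "Limit (R i)"
      unfolding Limit_def
    proof (intro conjI ballI)
      show "elts (R i) \<noteq> {}"
        using lim between by (auto simp: Limit_def)
      show "\<exists>\<gamma>\<in>elts (R i). x \<in> elts \<gamma>" if "x \<in> elts (R i)" for x
        using below[OF that] between Ri Ord_trans by blast
    qed (rule Ri)
    moreover have "unbounded_in (D \<inter> elts (R i)) (R i)"
      unfolding unbounded_in_def
    proof (intro conjI ballI)
      fix x assume x: "x \<in> elts (R i)"
      obtain j where j: "j \<in> elts i" "x \<in> elts (R j)"
        using below[OF x] by blast
      obtain \<beta> where \<beta>: "\<beta> \<in> D \<inter> elts (R i)" "R j \<in> elts \<beta>"
        using between[OF j(1)] by blast
      have "Ord \<beta>"
        using \<beta>(1) Ri Ord_mem by blast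
      then have "elts x \<subseteq> elts \<beta>"
        using \<beta>(2) j(2) Ord_trans by blast
      then show "\<exists>\<beta>\<in>D \<inter> elts (R i). elts x \<subseteq> elts \<beta>"
        using \<beta>(1) by blast
    qed simp
    ultimately show ?thesis
      using D R\<rho>[OF iw] unfolding club_in_def by blast
  qed
  moreover have "club_in ?C w"
    using closure_points_club[OF w] dk by blast
  ultimately show thesis
    using that by blast
qed

lemma stationary_pushforward:
  assumes w: "first_uncountable (w :: 'v::set_universe)" and R: "continuous_cofinal w R \<rho>"
    and A: "stationary_in {i \<in> elts w. R i \<in> A} w"
  shows "stationary_in (A \<inter> elts \<rho>) \<rho>"
  unfolding stationary_in_def
proof (intro conjI allI impI)
  fix D assume D: "club_in D \<rho>"
  obtain C where C: "club_in C w" "R ` C \<subseteq> D"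
    using club_pullback[OF w R D] by blast
  then obtain i where "i \<in> elts w" "R i \<in> A" "i \<in> C"
    using A unfolding stationary_in_def by blast
  then show "A \<inter> elts \<rho> \<inter> D \<noteq> {}"
    using C(2) continuous_cofinalD(2)[OF R] by blast
qed simp


section \<open>Closure under finitary functions\<close>

text \<open>
  A surjection of \<open>A\<close> onto \<open>A \<times> A\<close> can be iterated to decode one element of \<open>A\<close> into a list of any
  prescribed length.
\<close>

lemma lists_lepoll_infinite:
  assumes "infinite A" shows "lists A \<lesssim> A"
proof -
  have "A \<times> A \<lesssim> A"
    using card_of_Times_same_infinite[OF assms] eqpoll_iff_card_of_ordIso eqpoll_imp_lepoll by blast
  then obtain q where q: "A \<times> A \<subseteq> q ` A"
    by (auto simp: lepoll_iff)
  define g where "g = rec_nat (\<lambda>_. []) (\<lambda>n r a. fst (q a) # r (snd (q a)))"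
  have g: "g 0 a = []" "g (Suc n) a = fst (q a) # g n (snd (q a))" for n a
    by (simp_all add: g_def)
  have "\<exists>a\<in>A. xs = g (length xs) a" if "xs \<in> lists A" for xs
    using that
  proof (induction xs)
    case Nil
    then show ?case
      using assms g(1) by (metis ex_in_conv infinite_imp_nonempty list.size(3))
  next
    case (Cons x xs)
    then obtain b where b: "b \<in> A" "xs = g (length xs) b"
      by auto
    then obtain a where "a \<in> A" "q a = (x, b)"
      using q Cons.hyps by (metis SigmaI imageE subsetD)
    then show ?case
      using b g(2) by (metis fst_conv length_Cons snd_conv)
  qed
  then have "lists A \<subseteq> (\<lambda>(n, a). g n a) ` (UNIV \<times> A)"
    by force
  then have "lists A \<lesssim> (UNIV :: nat set) \<times> A"
    by (rule subset_image_lepoll)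
  also have "(UNIV :: nat set) \<times> A \<lesssim> A \<times> A"
    using assms by (intro times_lepoll_mono) (simp_all add: infinite_le_lepoll[symmetric])
  also note \<open>A \<times> A \<lesssim> A\<close>
  finally show ?thesis .
qed

inductive_set closure_under :: "('a list \<Rightarrow> 'a) \<Rightarrow> 'a set \<Rightarrow> 'a set" for f B where
  base: "b \<in> B \<Longrightarrow> b \<in> closure_under f B"
| step: "as \<in> lists (closure_under f B) \<Longrightarrow> f as \<in> closure_under f B"

lemma closure_under_mono:
  assumes "B \<subseteq> C" shows "closure_under f B \<subseteq> closure_under f C"
proof
  show "x \<in> closure_under f C" if "x \<in> closure_under f B" for x
    using that by induction (use assms in \<open>auto intro: closure_under.intros\<close>)
qed

lemma closure_under_subset:
  assumes "f \<in> lists M \<rightarrow> M" "B \<subseteq> M" shows "closure_under f B \<subseteq> M"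
proof
  show "x \<in> M" if "x \<in> closure_under f B" for x
    using that by induction (use assms in auto)
qed

text \<open>
  The closure is exhausted by \<open>\<omega>\<close> stages, and countable sets have countably many finite lists.
\<close>

lemma countable_closure_under:
  assumes "countable B" shows "countable (closure_under f B)"
proof -
  define s where "s = rec_nat B (\<lambda>_ Z. Z \<union> f ` lists Z)"
  have s: "s 0 = B" "s (Suc n) = s n \<union> f ` lists (s n)" for n
    by (simp_all add: s_def)
  have count: "countable (s n)" for n
    by (induction n) (simp_all add: s assms)
  have mono: "s m \<subseteq> s n" if "m \<le> n" for m n
    by (rule lift_Suc_mono_le[OF _ that]) (simp add: s)
  have directed: "\<exists>n. as \<in> lists (s n)" if "as \<in> lists (\<Union>n. s n)" for as
    using that
  proof (induction as)
    case (Cons a as)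
    then obtain m n where "a \<in> s m" "as \<in> lists (s n)"
      by auto
    then have "a \<in> s (max m n)" "as \<in> lists (s (max m n))"
      using mono[of m "max m n"] mono[of n "max m n"] by auto
    then show ?case
      by auto
  qed auto
  have "x \<in> (\<Union>n. s n)" if "x \<in> closure_under f B" for x
    using that
  proof induction
    case (base b)
    then show ?case
      using s(1) by blast
  next
    case (step as)
    then have "as \<in> lists (\<Union>n. s n)"
      by auto
    then obtain n where "as \<in> lists (s n)"
      using directed by blast
    then have "f as \<in> s (Suc n)"
      by (simp add: s)
    then show ?case
      by blast
  qed
  then have "closure_under f B \<subseteq> (\<Union>n. s n)"
    by blast
  then show ?thesis
    by (rule countable_subset) (simp add: count)
qed

text \<open>
  The value of \<open>g\<close> at the list \<open>c n # bs\<close> is the \<open>n\<close>-th element of the countable closure of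
  \<open>set bs\<close> under \<open>f\<close>.  As every element of the closure of \<open>Y\<close> lies in the closure of a finite subset
  of \<open>Y\<close>, the set \<open>g ` lists Y\<close> is this closure whenever \<open>Y\<close> contains the codes \<open>c n\<close>.  The point is
  that \<open>g\<close> depends on \<open>f\<close> only and serves all \<open>Y\<close> at once, so that a stationary collection can be
  asked for a set \<open>Y\<close> closed under part of \<open>g\<close>; besides, the image bounds the cardinality of the
  closure.
\<close>

lemma closure_as_image:
  assumes f: "f \<in> lists M \<rightarrow> M" and c: "inj (c :: nat \<Rightarrow> 'a)"
  obtains g where "g \<in> lists M \<rightarrow> M"
    "\<And>Y. range c \<subseteq> Y \<Longrightarrow> Y \<subseteq> g ` lists Y"
    "\<And>Y as. range c \<subseteq> Y \<Longrightarrow> as \<in> lists (g ` lists Y) \<Longrightarrow> f as \<in> g ` lists Y"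
proof -
  define cl where "cl bs = closure_under f (set bs)" for bs
  define g where "g as = (case as of [] \<Rightarrow> f [] | x # bs \<Rightarrow> from_nat_into (cl bs) (inv c x))" for as
  \<comment> \<open>The closures are nonempty, so their enumerations do not produce default values.\<close>
  have fNil: "f [] \<in> cl bs" for bs
    unfolding cl_def by (rule closure_under.step) simp
  have g_cl: "g [] \<in> cl []" "g (x # bs) \<in> cl bs" for x bs
    using fNil[of bs] fNil[of "[]"] by (auto simp: g_def intro!: from_nat_into)
  have cl_g: "\<exists>n. z = g (c n # bs)" if z: "z \<in> cl bs" for z bs
  proof -
    have "countable (cl bs)"
      by (simp add: cl_def countable_closure_under countable_finite)
    then obtain n where "from_nat_into (cl bs) n = z"
      using from_nat_into_surj[OF _ z] by metis
    then have "z = g (c n # bs)"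
      by (simp add: g_def c)
    then show ?thesis
      by blast
  qed
  have image: "g ` lists Y = (\<Union>bs\<in>lists Y. cl bs)" if Y: "range c \<subseteq> Y" for Y
  proof
    have "g as \<in> (\<Union>bs\<in>lists Y. cl bs)" if "as \<in> lists Y" for as
      using that g_cl by (cases as) force+
    then show "g ` lists Y \<subseteq> (\<Union>bs\<in>lists Y. cl bs)"
      by blast
    have "z \<in> g ` lists Y" if z: "bs \<in> lists Y" "z \<in> cl bs" for bs z
    proof -
      obtain n where "z = g (c n # bs)"
        using cl_g z(2) by blast
      moreover have "c n # bs \<in> lists Y"
        using Y z(1) by auto
      ultimately show ?thesis
        by blast
    qed
    then show "(\<Union>bs\<in>lists Y. cl bs) \<subseteq> g ` lists Y"
      by blast
  qed
  have cl_mono: "cl bs \<subseteq> cl bs'" if "set bs \<subseteq> set bs'" for bs bs'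
    unfolding cl_def by (rule closure_under_mono[OF that])
  have directed: "\<exists>bs\<in>lists Y. as \<in> lists (cl bs)" if "as \<in> lists (\<Union>bs\<in>lists Y. cl bs)" for as Y
    using that
  proof (induction as)
    case (Cons a as)
    then obtain bs bs' where bs: "bs \<in> lists Y" "a \<in> cl bs" "bs' \<in> lists Y" "as \<in> lists (cl bs')"
      by auto
    then have "a \<in> cl (bs @ bs')" "as \<in> lists (cl (bs @ bs'))"
      using cl_mono[of bs "bs @ bs'"] cl_mono[of bs' "bs @ bs'"] by auto
    then show ?case
      using bs by (intro bexI[of _ "bs @ bs'"]) auto
  qed auto
  show thesis
  proof
    have "cl bs \<subseteq> M" if "bs \<in> lists M" for bs
      unfolding cl_def by (rule closure_under_subset[OF f]) (use that in auto)
    then have "g as \<in> M" if "as \<in> lists M" for as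
      using that g_cl by (cases as) force+
    then show "g \<in> lists M \<rightarrow> M"
      by blast
    show "Y \<subseteq> g ` lists Y" if Y: "range c \<subseteq> Y" for Y
    proof
      fix y assume "y \<in> Y"
      moreover have "y \<in> cl [y]"
        unfolding cl_def by (rule closure_under.base) simp
      ultimately have "[y] \<in> lists Y" "y \<in> cl [y]"
        by auto
      then show "y \<in> g ` lists Y"
        unfolding image[OF Y] by blast
    qed
    show "f as \<in> g ` lists Y" if Y: "range c \<subseteq> Y" and as: "as \<in> lists (g ` lists Y)" for Y as
    proof -
      obtain bs where bs: "bs \<in> lists Y" "as \<in> lists (cl bs)"
        using directed[OF as[unfolded image[OF Y]]] by (rule bexE)
      moreover from bs(2) have "f as \<in> cl bs"
        unfolding cl_def by (rule closure_under.step)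
      ultimately show ?thesis
        unfolding image[OF Y] by blast
    qed
  qed
qed

text \<open>
  Countably many functions are combined into one by letting the first entry of the argument list
  select the function.  Values outside \<open>M\<close> are replaced by a default, so the functions may be
  partial operations on \<open>M\<close>.
\<close>

lemma stationary_over_closed:
  assumes stat: "stationary_over \<X> (M :: 'v::set_universe set)"
    and c: "inj (c :: nat \<Rightarrow> 'v)" "range c \<subseteq> M" "\<And>x. x \<in> \<X> \<Longrightarrow> range c \<subseteq> elts x"
    and \<G>: "countable \<G>"
  obtains x where "x \<in> \<X>" "elts x \<subseteq> M"
    "\<And>G as. G \<in> \<G> \<Longrightarrow> as \<in> lists (elts x) \<Longrightarrow> G as \<in> M \<Longrightarrow> G as \<in> elts x"
proof -
  \<comment> \<open>The code \<open>c n\<close> in front of the arguments selects the \<open>n\<close>-th function.\<close>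
  define f where "f as = (let G = from_nat_into \<G> (inv c (hd as)) in
      if G (tl as) \<in> M then G (tl as) else c 0)" for as
  have "c 0 \<in> M"
    using c(2) by blast
  then have "f \<in> lists M \<rightarrow> M"
    by (auto simp: f_def Let_def)
  then obtain x where x: "x \<in> \<X>" "elts x \<subseteq> M" "\<And>as. as \<in> lists (elts x) \<Longrightarrow> f as \<in> elts x"
    using stat unfolding stationary_over_def by meson
  show thesis
  proof (rule that)
    fix G as assume G: "G \<in> \<G>" "as \<in> lists (elts x)" "G as \<in> M"
    obtain n where n: "from_nat_into \<G> n = G"
      using from_nat_into_surj[OF \<G> G(1)] by metis
    have "c n \<in> elts x"
      using c(3)[OF x(1)] by blast
    then have "f (c n # as) \<in> elts x"
      using G(2) by (intro x(3)) simp
    then show "G as \<in> elts x"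
      using G(3) n c(1) by (simp add: f_def)
  qed (use x in auto)
qed

section \<open>Hereditary cardinality\<close>

lemma trcl_trans: "y \<in> elts z \<Longrightarrow> z \<in> elts x \<Longrightarrow> y \<in> trcl x"
  unfolding trcl_def by (auto intro: trancl_trans)

lemma trcl_subset:
  assumes "elts x \<subseteq> T" "\<And>y. y \<in> T \<Longrightarrow> elts y \<subseteq> T" shows "trcl x \<subseteq> T"
proof
  fix y assume "y \<in> trcl x"
  then have "(y, x) \<in> {(u, v). u \<in> elts v}\<^sup>+"
    by (simp add: trcl_def)
  then show "y \<in> T"
    by (induction rule: converse_trancl_induct) (use assms in auto)
qed

lemma Card_subset_H:
  assumes "Card \<kappa>" shows "elts \<kappa> \<subseteq> H \<kappa>"
proof
  fix \<alpha> assume \<alpha>: "\<alpha> \<in> elts \<kappa>"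
  have O: "Ord \<kappa>" "\<not> elts \<alpha> \<approx> elts \<kappa>"
    using assms \<alpha> by (auto simp: Card_def)
  have "trcl \<alpha> \<subseteq> elts \<alpha>"
    by (rule trcl_subset) (use O(1) \<alpha> Ord_mem Ord_trans in blast)+
  moreover have "elts \<alpha> \<subseteq> elts \<kappa>"
    using O(1) \<alpha> Ord_trans by blast
  then have "elts \<alpha> \<prec> elts \<kappa>"
    using O(2) by (simp add: lesspoll_def subset_imp_lepoll)
  ultimately show "\<alpha> \<in> H \<kappa>"
    unfolding H_def using lesspoll_trans1 subset_imp_lepoll by blast
qed

lemma subset_Ord_in_H:
  assumes "Ord \<kappa>" "elts \<kappa> \<prec> elts \<theta>" "elts A \<subseteq> elts \<kappa>" shows "A \<in> H \<theta>"
proof -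
  have "trcl A \<subseteq> elts \<kappa>"
    by (rule trcl_subset) (use assms Ord_trans in blast)+
  then show ?thesis
    unfolding H_def using assms(2) lesspoll_trans1 subset_imp_lepoll by blast
qed

lemma succ_mem_Card:
  assumes "Card \<kappa>" "infinite (elts \<kappa>)" "\<alpha> \<in> elts (\<kappa> :: 'v::set_universe)"
  shows "succ \<alpha> \<in> elts \<kappa>"
proof -
  have O: "Ord \<kappa>" "\<not> elts \<alpha> \<approx> elts \<kappa>" "Ord \<alpha>"
    using assms Ord_mem by (auto simp: Card_def)
  have "succ \<alpha> \<noteq> \<kappa>"
  proof
    assume eq: "succ \<alpha> = \<kappa>"
    then have "elts \<kappa> = insert \<alpha> (elts \<alpha>)"
      by auto
    then show False
      using O(2) assms(2) infinite_insert_eqpoll[of "elts \<alpha>" \<alpha>] eqpoll_sym by auto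
  qed
  moreover have "\<kappa> \<notin> elts (succ \<alpha>)"
    using O assms(3) Ord_trans by (metis elts_succ insert_iff mem_irrefl)
  ultimately show ?thesis
    using Ord_linear[OF Ord_succ[OF O(3)] O(1)] by blast
qed

lemma stationary_in_unbounded:
  assumes "Ord \<kappa>" "stationary_in A \<kappa>" "\<alpha> \<in> elts (\<kappa> :: 'v::set_universe)"
  obtains \<beta> where "\<beta> \<in> A" "elts \<alpha> \<subseteq> elts \<beta>"
proof -
  let ?C = "{\<beta> \<in> elts \<kappa>. elts \<alpha> \<subseteq> elts \<beta>}"
  have "\<exists>\<beta>\<in>?C. elts \<gamma> \<subseteq> elts \<beta>" if "\<gamma> \<in> elts \<kappa>" for \<gamma>
  proof (cases "elts \<alpha> \<subseteq> elts \<gamma>")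
    case False
    then have "\<gamma> \<in> elts \<alpha>"
      using that assms(1,3) Ord_mem Ord_not_subset by blast
    then have "elts \<gamma> \<subseteq> elts \<alpha>"
      using assms(1,3) Ord_mem Ord_trans by blast
    then show ?thesis
      using assms(3) by blast
  qed (use that in blast)
  then have "unbounded_in ?C \<kappa>"
    unfolding unbounded_in_def by blast
  moreover have "\<gamma> \<in> ?C"
    if \<gamma>: "\<gamma> \<in> elts \<kappa>" "Limit \<gamma>" "unbounded_in (?C \<inter> elts \<gamma>) \<gamma>" for \<gamma>
  proof -
    have "elts \<gamma> \<noteq> {}"
      using \<gamma>(2) by (simp add: Limit_def)
    then obtain \<beta> where "\<beta> \<in> ?C" "\<beta> \<in> elts \<gamma>"
      using \<gamma>(3) unfolding unbounded_in_def by blast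
    moreover have "elts \<beta> \<subseteq> elts \<gamma>"
      using \<open>\<beta> \<in> elts \<gamma>\<close> Limit_Ord[OF \<gamma>(2)] Ord_trans by blast
    ultimately show ?thesis
      using \<gamma>(1) by blast
  qed
  ultimately have "club_in ?C \<kappa>"
    unfolding club_in_def by blast
  then have "A \<inter> ?C \<noteq> {}"
    using assms(2) unfolding stationary_in_def by blast
  then show thesis
    using that by blast
qed

text \<open>
  Every \<open>\<alpha> < \<kappa>\<close> occurs in the transitive closure of the lift: take \<open>\<epsilon> \<in> E\<close> with \<open>\<alpha> \<le> \<epsilon>\<close>; the pair
  \<open>{\<alpha>, \<epsilon>}\<close> has supremum \<open>\<epsilon>\<close> and so belongs to \<open>lift E \<kappa>\<close>.
\<close>

lemma lesspoll_of_lift_in_H: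
  assumes \<kappa>: "Card \<kappa>" and E: "stationary_in (elts E) \<kappa>"
    and s: "elts s = lift E \<kappa>" "s \<in> H (\<theta> :: 'v::set_universe)"
  shows "elts \<kappa> \<prec> elts \<theta>"
proof -
  have O\<kappa>: "Ord \<kappa>"
    using \<kappa> by (simp add: Card_def)
  have "elts \<kappa> \<subseteq> trcl s"
  proof
    fix \<alpha> assume \<alpha>: "\<alpha> \<in> elts \<kappa>"
    obtain \<epsilon> where \<epsilon>: "\<epsilon> \<in> elts E" "elts \<alpha> \<subseteq> elts \<epsilon>"
      using stationary_in_unbounded[OF O\<kappa> E \<alpha>] by blast
    have "\<epsilon> \<in> elts \<kappa>"
      using \<epsilon>(1) E by (auto simp: stationary_in_def)
    define x where "x = vset {\<alpha>, \<epsilon>}"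
    have x: "elts x = {\<alpha>, \<epsilon>}"
      unfolding x_def by (rule elts_vset[OF small_pair])
    then have "elts x \<inter> elts \<kappa> = {\<alpha>, \<epsilon>}"
      using \<alpha> \<open>\<epsilon> \<in> elts \<kappa>\<close> by auto
    then have "elts (osup (elts x \<inter> elts \<kappa>)) = elts \<epsilon>"
      using elts_osup[OF small_pair, of \<alpha> \<epsilon>] \<epsilon>(2) by auto
    then have "osup (elts x \<inter> elts \<kappa>) = \<epsilon>"
      by (rule extensionality)
    moreover have "x \<in> countable_subsets (H \<kappa>)"
      using x \<alpha> \<open>\<epsilon> \<in> elts \<kappa>\<close> Card_subset_H[OF \<kappa>] by (auto simp: countable_subsets_def)
    ultimately have "x \<in> elts s"
      using \<epsilon>(1) by (simp add: s lift_def)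
    then show "\<alpha> \<in> trcl s"
      using trcl_trans[of \<alpha> x s] x by simp
  qed
  then show ?thesis
    using s(2) unfolding H_def using lesspoll_trans1 subset_imp_lepoll by blast
qed

section \<open>Reflection at the supremum of an exact diagonal chain\<close>

text \<open>
  The hypotheses \<open>up\<close>, \<open>down\<close> and \<open>next_sup\<close> are the instances of elementarity of \<open>X\<close> that the
  argument uses: \<open>up\<close> and \<open>down\<close> translate between the stationary sets in \<open>X\<close> and their lifts, about
  which the chain speaks, and \<open>next_sup\<close> keeps the suprema of the \<open>Q i\<close> strictly below the supremum
  of \<open>X\<close>.
\<close>

lemma exact_reflection_of_chain:
  assumes \<kappa>: "regular_card \<kappa>" "omega1 \<in> elts (\<kappa> :: 'v::set_universe)"
    and w: "first_uncountable (omega1 :: 'v)"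
    and E: "elts E \<subseteq> elts \<kappa>"
    and \<S>: "\<S> = {lift A \<kappa> | A. elts A \<subseteq> elts E \<and> stationary_in (elts A) \<kappa>}"
    and X: "elts X \<lesssim> elts (omega1 :: 'v)"
    and Q: "exact_diagonal_chain \<kappa> \<S> X Q"
    and up: "\<And>A. A \<in> elts X \<Longrightarrow> elts A \<subseteq> elts E \<Longrightarrow> stationary_in (elts A) \<kappa> \<Longrightarrow>
               \<exists>S\<in>elts X. elts S = lift A \<kappa>"
    and down: "\<And>S. S \<in> elts X \<Longrightarrow> elts S \<in> \<S> \<Longrightarrow>
               \<exists>A\<in>elts X. elts A \<subseteq> elts E \<and> stationary_in (elts A) \<kappa> \<and> elts S = lift A \<kappa>"
    and next_sup: "\<And>x. x \<in> elts X \<Longrightarrow> osup (elts x \<inter> elts \<kappa>) \<in> elts \<kappa> \<Longrightarrow>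
               succ (osup (elts x \<inter> elts \<kappa>)) \<in> elts X"
  shows "exact_simultaneous_reflection_point \<kappa>
           {A \<in> elts X. elts A \<subseteq> elts E \<and> stationary_in (elts A) \<kappa>} (osup (elts X \<inter> elts \<kappa>))"
proof -
  let ?w = "omega1 :: 'v"
  let ?\<A> = "{A \<in> elts X. elts A \<subseteq> elts E \<and> stationary_in (elts A) \<kappa>}"
  define \<rho> where "\<rho> = osup (elts X \<inter> elts \<kappa>)"
  define R where "R i = osup (elts (Q i) \<inter> elts \<kappa>)" for i
  have card: "Card \<kappa>" "infinite (elts \<kappa>)" "Ord \<kappa>"
    using \<kappa>(1) by (auto simp: regular_card_def Card_def)
  have Q_succ: "\<And>i. i \<in> elts ?w \<Longrightarrow> Q i \<in> elts (Q (succ i))"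
    and Q_limit: "\<And>l. l \<in> elts ?w \<Longrightarrow> Limit l \<Longrightarrow> elts (Q l) = (\<Union>i\<in>elts l. elts (Q i))"
    and Q_stat: "\<And>S. S \<in> elts X \<Longrightarrow> elts S \<in> \<S> \<Longrightarrow> stationary_in {i \<in> elts ?w. Q i \<in> elts S} ?w"
    and Q_union: "H \<kappa> \<inter> elts X = (\<Union>i\<in>elts ?w. elts (Q i))"
    and Q_exact: "\<And>i. i \<in> elts ?w \<Longrightarrow> \<exists>S\<in>elts X. elts S \<in> \<S> \<and> Q i \<in> elts S"
    using Q unfolding exact_diagonal_chain_def by blast+
  have small: "small (elts x \<inter> elts \<kappa>)" for x :: 'v
    by (rule small_subset[of "elts x"]) auto
  have elts_R: "elts (R i) = (\<Union>\<alpha>\<in>elts (Q i) \<inter> elts \<kappa>. elts \<alpha>)" for i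
    unfolding R_def by (rule elts_osup[OF small])
  have elts_\<rho>: "elts \<rho> = (\<Union>\<alpha>\<in>elts X \<inter> elts \<kappa>. elts \<alpha>)"
    unfolding \<rho>_def by (rule elts_osup[OF small])
  have R_mem: "\<exists>A\<in>?\<A>. R i \<in> elts A" if i: "i \<in> elts ?w" for i
  proof -
    obtain S where S: "S \<in> elts X" "elts S \<in> \<S>" "Q i \<in> elts S"
      using Q_exact[OF i] by blast
    obtain A where A: "A \<in> ?\<A>" "elts S = lift A \<kappa>"
      using down[OF S(1,2)] by blast
    have "R i \<in> elts A"
      using S(3) unfolding A(2) lift_def R_def by simp
    then show ?thesis
      using A(1) by blast
  qed
  have R_\<kappa>: "R i \<in> elts \<kappa>" if "i \<in> elts ?w" for i
    using R_mem[OF that] E by blast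
  have "succ i \<in> elts ?w" if i: "i \<in> elts ?w" for i
  proof -
    have O: "Ord i" "Ord ?w"
      using w i Ord_mem by (auto simp: first_uncountable_def)
    obtain l where l: "l \<in> elts ?w" "Limit l" "{i} \<subseteq> elts l"
      by (rule Limit_above[OF w, of "{i}"]) (use i in auto)
    then have "elts (succ i) \<subseteq> elts l"
      using Ord_trans[OF Limit_Ord[OF l(2)]] by auto
    then show ?thesis
      using Ord_subset_mem[OF Ord_succ[OF O(1)] O(2)] l(1) by blast
  qed
  then have Q_X: "Q i \<in> elts X" if "i \<in> elts ?w" for i
    using Q_succ[OF that] Q_union that by blast
  have \<rho>\<kappa>: "\<rho> \<in> elts \<kappa>"
    unfolding \<rho>_def
  proof (rule osup_mem_regular_card[OF \<kappa>])
    show "elts X \<inter> elts \<kappa> \<lesssim> elts ?w"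
      using X lepoll_trans subset_imp_lepoll by blast
  qed simp
  have R: "continuous_cofinal ?w R \<rho>"
    unfolding continuous_cofinal_def
  proof (intro conjI ballI impI)
    show "Ord \<rho>"
      using \<rho>\<kappa> card(3) Ord_mem by blast
    show "R i \<in> elts \<rho>" if i: "i \<in> elts ?w" for i
    proof -
      have "succ (R i) \<in> elts X"
        using next_sup[OF Q_X[OF i]] R_\<kappa>[OF i] unfolding R_def by blast
      moreover have "succ (R i) \<in> elts \<kappa>"
        by (rule succ_mem_Card[OF card(1,2) R_\<kappa>[OF i]])
      moreover have "R i \<in> elts (succ (R i))"
        by simp
      ultimately show ?thesis
        unfolding elts_\<rho> by blast
    qed
    have "elts X \<inter> elts \<kappa> = (\<Union>i\<in>elts ?w. elts (Q i)) \<inter> elts \<kappa>"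
      using Q_union Card_subset_H[OF card(1)] by blast
    then show "elts \<rho> = (\<Union>i\<in>elts ?w. elts (R i))"
      unfolding elts_\<rho> elts_R by blast
    show "elts (R l) = (\<Union>i\<in>elts l. elts (R i))" if "l \<in> elts ?w" "Limit l" for l
      unfolding elts_R Q_limit[OF that] by blast
  qed
  have cf: "omega \<in> elts (cf \<rho>)"
    by (rule omega_mem_cf[OF w R])
  have "reflection_point \<kappa> A \<rho>" if A: "A \<in> ?\<A>" for A
  proof -
    obtain S where S: "S \<in> elts X" "elts S = lift A \<kappa>"
      using up A by blast
    then have "elts S \<in> \<S>"
      using A \<S> by blast
    then have "stationary_in {i \<in> elts ?w. Q i \<in> elts S} ?w"
      using Q_stat S(1) by blast
    moreover have "{i \<in> elts ?w. Q i \<in> elts S} \<subseteq> {i \<in> elts ?w. R i \<in> elts A}"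
      unfolding S(2) lift_def R_def by blast
    ultimately have "stationary_in {i \<in> elts ?w. R i \<in> elts A} ?w"
      unfolding stationary_in_def by blast
    then have "stationary_in (elts A \<inter> elts \<rho>) \<rho>"
      by (rule stationary_pushforward[OF w R])
    then show ?thesis
      unfolding reflection_point_def using \<rho>\<kappa> cf by blast
  qed
  moreover have "club_in (R ` {l \<in> elts ?w. Limit l}) \<rho>"
    by (rule limit_values_club[OF w R])
  moreover have "R ` {l \<in> elts ?w. Limit l} \<subseteq> (\<Union>A\<in>?\<A>. elts A) \<inter> elts \<rho>"
    using R_mem continuous_cofinalD(2)[OF R] by blast
  ultimately show ?thesis
    unfolding exact_simultaneous_reflection_point_def \<rho>_def[symmetric] using \<rho>\<kappa> cf by blast
qed

theorem lemma6p13: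
  fixes \<kappa> \<theta> E :: "'v::set_universe" and \<S> :: "'v set set"
  assumes "regular_card \<kappa>" and "omega1 \<in> elts \<kappa>"
    and "elts E \<subseteq> cof_omega \<kappa>" and "stationary_in (elts E) \<kappa>"
    and "\<S> = {lift A \<kappa> | A. elts A \<subseteq> elts E \<and> stationary_in (elts A) \<kappa>}"
    and "Card \<theta>" and "\<S> \<subseteq> elts ` H \<theta>"
    and "eDSRP \<kappa> \<S>"
  shows "stationary_over
           {W \<in> omega1_subsets (H \<theta>).
              elts omega1 \<subseteq> elts W \<and>
              exact_simultaneous_reflection_point \<kappa>
                {A \<in> elts W. elts A \<subseteq> elts E \<and> stationary_in (elts A) \<kappa>}
                (osup (elts W \<inter> elts \<kappa>))}
           (H \<theta>)"
  unfolding stationary_over_def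
proof (intro ballI)
  let ?w = "omega1 :: 'v"
  let ?P = "\<lambda>A. elts A \<subseteq> elts E \<and> stationary_in (elts A) \<kappa>"
  fix f assume f: "f \<in> lists (H \<theta>) \<rightarrow> H \<theta>"
  have card: "Card \<kappa>" "Ord \<kappa>"
    using assms(1) by (auto simp: regular_card_def Card_def)
  have E\<kappa>: "elts E \<subseteq> elts \<kappa>"
    using assms(3) by (auto simp: cof_omega_def)
  have lift_mem: "lift A \<kappa> \<in> \<S>" if "?P A" for A
    using that assms(5) by blast
  have w\<kappa>: "elts ?w \<subseteq> elts \<kappa>"
    using assms(2) card(2) Ord_trans by blast

  \<comment> \<open>The existence of \<open>\<omega>\<^sub>1\<close> is a consequence of \<open>E\<close> being nonempty.\<close>
  obtain \<epsilon> where "\<epsilon> \<in> elts E"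
    using stationary_in_unbounded[OF card(2) assms(4) assms(2)] by blast
  then have "uncountable (elts \<kappa>)"
    using uncountable_if_cof_omega[OF card(1), of \<epsilon>] assms(3) by (auto simp: cof_omega_def)
  then have w: "first_uncountable ?w"
    by (rule first_uncountable_omega1[OF card(2)])
  then have "infinite (elts ?w)"
    by (auto simp: first_uncountable_def countable_finite)
  then obtain c :: "nat \<Rightarrow> 'v" where c: "inj c" "range c \<subseteq> elts ?w"
    using infinite_countable_subset by blast

  obtain \<theta>' where \<theta>': "\<S> \<subseteq> elts ` H \<theta>'"
    "stationary_over {X \<in> omega1_subsets (H \<theta>').
       elts ?w \<subseteq> elts X \<and> (\<exists>Q. exact_diagonal_chain \<kappa> \<S> X Q)} (H \<theta>')"
    using assms(8) unfolding eDSRP_def by blast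
  have less: "elts \<kappa> \<prec> elts \<tau>" if "\<S> \<subseteq> elts ` H \<tau>" for \<tau>
  proof -
    have "lift E \<kappa> \<in> elts ` H \<tau>"
      using that lift_mem[of E] assms(4) by blast
    then show ?thesis
      using lesspoll_of_lift_in_H[OF card(1) assms(4)] by (metis imageE)
  qed
  have sub_H: "A \<in> H \<theta>" "A \<in> H \<theta>'" if "elts A \<subseteq> elts \<kappa>" for A
    using subset_Ord_in_H[OF card(2) less[OF assms(7)] that]
      subset_Ord_in_H[OF card(2) less[OF \<theta>'(1)] that] by simp_all
  then have \<kappa>H: "elts \<kappa> \<subseteq> H \<theta>" "elts \<kappa> \<subseteq> H \<theta>'"
    using card(2) Ord_trans by blast+

  obtain g where g: "g \<in> lists (H \<theta>) \<rightarrow> H \<theta>"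
    "\<And>Y. range c \<subseteq> Y \<Longrightarrow> Y \<subseteq> g ` lists Y"
    "\<And>Y as. range c \<subseteq> Y \<Longrightarrow> as \<in> lists (g ` lists Y) \<Longrightarrow> f as \<in> g ` lists Y"
    by (rule closure_as_image[OF f c(1)]) blast
  define up where "up as = vset (lift (hd as) \<kappa>)" for as
  define down where "down as = (SOME A. ?P A \<and> elts (hd as) = lift A \<kappa>)" for as
  define next_sup where "next_sup as = succ (osup (elts (hd as) \<inter> elts \<kappa>))" for as
  obtain X where X: "X \<in> omega1_subsets (H \<theta>')" "elts ?w \<subseteq> elts X"
      "\<exists>Q. exact_diagonal_chain \<kappa> \<S> X Q" "elts X \<subseteq> H \<theta>'"
    and closed: "\<And>G as. G \<in> {g, up, down, next_sup} \<Longrightarrow> as \<in> lists (elts X) \<Longrightarrow> G as \<in> H \<theta>' \<Longrightarrow> G as \<in> elts X"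
    by (rule stationary_over_closed[OF \<theta>'(2) c(1), of "{g, up, down, next_sup}"])
      (use c(2) w\<kappa> \<kappa>H(2) in auto)
  obtain Q where Q: "exact_diagonal_chain \<kappa> \<S> X Q"
    using X(3) by blast
  have Xw: "elts X \<approx> elts ?w"
    using X(1) by (simp add: omega1_subsets_def)

  \<comment> \<open>\<open>W\<close> is the closure of \<open>X \<inter> H(\<theta>)\<close> under \<open>f\<close>; within \<open>H(\<theta>')\<close> it adds nothing to \<open>X\<close>, because
    \<open>X\<close> is closed under the part of \<open>g\<close> with values there.\<close>
  define Y where "Y = elts X \<inter> H \<theta>"
  have wY: "elts ?w \<subseteq> Y"
    using X(2) w\<kappa> \<kappa>H(1) by (auto simp: Y_def)
  then have cY: "range c \<subseteq> Y"
    using c(2) by blast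
  have "infinite Y"
    using wY \<open>infinite (elts ?w)\<close> finite_subset by blast
  then have YY: "g ` lists Y \<lesssim> Y"
    using image_lepoll lepoll_trans lists_lepoll_infinite by blast
  moreover have Y_X: "Y \<subseteq> elts X"
    by (auto simp: Y_def)
  ultimately have "small (g ` lists Y)"
    using small_lepoll small_subset small_elts by metis
  define W where "W = vset (g ` lists Y)"
  have W: "elts W = g ` lists Y"
    unfolding W_def by (rule elts_vset) fact
  have YW: "Y \<subseteq> elts W"
    unfolding W by (rule g(2)[OF cY])
  have W_H: "elts W \<subseteq> H \<theta>"
    unfolding W using g(1) by (auto simp: Y_def)
  have W_X: "elts W \<inter> H \<theta>' \<subseteq> elts X"
    unfolding W using closed[of g] Y_X by blast
  have "elts W \<lesssim> elts ?w"
    using YY Y_X Xw unfolding W by (meson lepoll_trans lepoll_trans2 subset_imp_lepoll)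
  moreover have wW: "elts ?w \<subseteq> elts W"
    using wY YW by blast
  ultimately have "W \<in> omega1_subsets (H \<theta>)"
    unfolding omega1_subsets_def using W_H by (simp add: lepoll_antisym subset_imp_lepoll)
  moreover have "A \<in> elts W \<longleftrightarrow> A \<in> elts X" if "elts A \<subseteq> elts \<kappa>" for A
    using sub_H[OF that] W_X YW unfolding Y_def by blast
  then have "{A \<in> elts W. ?P A} = {A \<in> elts X. ?P A}" "elts W \<inter> elts \<kappa> = elts X \<inter> elts \<kappa>"
    using E\<kappa> card(2) Ord_trans by blast+
  moreover have "exact_simultaneous_reflection_point \<kappa> {A \<in> elts X. ?P A} (osup (elts X \<inter> elts \<kappa>))"
  proof (rule exact_reflection_of_chain[OF assms(1,2) w E\<kappa> assms(5) eqpoll_imp_lepoll[OF Xw] Q])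
    fix A assume A: "A \<in> elts X" "elts A \<subseteq> elts E" "stationary_in (elts A) \<kappa>"
    obtain S where S: "S \<in> H \<theta>'" "elts S = lift A \<kappa>"
      using lift_mem[of A] A \<theta>'(1) by (metis imageE subsetD)
    then have "up [A] = S"
      by (metis list.sel(1) up_def vset_elts)
    then have "S \<in> elts X"
      using closed[of up "[A]"] A(1) S(1) by simp
    then show "\<exists>S\<in>elts X. elts S = lift A \<kappa>"
      using S(2) by blast
  next
    fix S assume S: "S \<in> elts X" "elts S \<in> \<S>"
    have "\<exists>A. ?P A \<and> elts (hd [S]) = lift A \<kappa>"
      using S(2) assms(5) by auto
    then have A: "?P (down [S]) \<and> elts (hd [S]) = lift (down [S]) \<kappa>"
      unfolding down_def by (rule someI_ex)
    then have "down [S] \<in> H \<theta>'"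
      using sub_H(2) E\<kappa> by blast
    then have "down [S] \<in> elts X"
      using closed[of down "[S]"] S(1) by simp
    then show "\<exists>A\<in>elts X. elts A \<subseteq> elts E \<and> stationary_in (elts A) \<kappa> \<and> elts S = lift A \<kappa>"
      using A by auto
  next
    fix x assume x: "x \<in> elts X" "osup (elts x \<inter> elts \<kappa>) \<in> elts \<kappa>"
    have "succ (osup (elts x \<inter> elts \<kappa>)) \<in> elts \<kappa>"
      by (rule succ_mem_Card[OF card(1) _ x(2)]) (use assms(1) regular_card_def in blast)
    then have "next_sup [x] \<in> H \<theta>'"
      using \<kappa>H(2) by (auto simp: next_sup_def)
    then have "next_sup [x] \<in> elts X"
      using closed[of next_sup "[x]"] x(1) by simp
    then show "succ (osup (elts x \<inter> elts \<kappa>)) \<in> elts X"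
      by (simp add: next_sup_def)
  qed
  moreover have "\<forall>as\<in>lists (elts W). f as \<in> elts W"
    unfolding W using g(3)[OF cY] by blast
  ultimately show "\<exists>W\<in>{W \<in> omega1_subsets (H \<theta>). elts ?w \<subseteq> elts W \<and>
       exact_simultaneous_reflection_point \<kappa> {A \<in> elts W. ?P A} (osup (elts W \<inter> elts \<kappa>))}.
     elts W \<subseteq> H \<theta> \<and> (\<forall>as\<in>lists (elts W). f as \<in> elts W)"
    using wW W_H by (intro bexI[of _ W]) simp_all
qed

end
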